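(* Let $I \subseteq \mathbf{R}$ be a non-empty interval, let $f, g: I \to \mathbf{R}$ be continuous injections, and let $(X, \mathscr{L}, \lambda)$ and $(Y, \mathscr{M}, \mu)$ be probability spaces. Assume that $\lambda$ and $\mu$ are non-degenerate. Then $(f,g)$ is a $(\lambda,\mu)$-switch if and only if there exist $a, b \in \mathbf{R}$, $a \neq 0$, such that $f = ag + b$ (that is, $f(x) = a\,g(x) + b$ for all $x \in I$).
   Context: The interval $I$ may be bounded or unbounded, need not be open or closed, and may be a single point. For an injection $w: I \to \mathbf{R}$, $w^{-1}: w[I] \to I$ denotes the inverse of the corestriction of $w$ to its image $w[I] = \{w(x) : x \in I\}$. Integrals are Lebesgue integrals; a real-valued function is $\mathscr{C}$-measurable if it is measurable with respect to the sigma-algebra $\mathscr{C}$ and the Borel sigma-algebra of $\mathbf{R}$. A probability measure $\gamma$ on a sigma-algebra $\mathscr{C}$ is non-degenerate if $\gamma[\mathscr{C}] \neq \{0,1\}$, i.e. there is $A \in \mathscr{C}$ with $0 < \gamma(A) < 1$. The pair $(f,g)$ is a $(\lambda,\mu)$-switch if, for every $\mathscr{L}\otimes\mathscr{M}$-measurable function $h: X \times Y \to I$ whose image $h[X\times Y]$ is contained in a compact subset of $I$, it holds $$f^{-1}\!\left(\int_X f\!\left(g^{-1}\!\left(\int_Y g(h(x,y))\,d\mu(y)\right)\right)d\lambda(x)\right) = g^{-1}\!\left(\int_Y g\!\left(f^{-1}\!\left(\int_X f(h(x,y))\,d\lambda(x)\right)\right)d\mu(y)\right).$$ (All expressions in this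 equation are well-defined for such $h$.) *)

theory Defs
  imports "HOL-Analysis.Analysis" "HOL-Probability.Probability_Measure"
begin

definition nondegenerate :: "'a measure \<Rightarrow> bool" where
  "nondegenerate M \<longleftrightarrow> measure M ` sets M \<noteq> {0, 1}"

lemma (in prob_space) nondegenerate_iff:
  "nondegenerate M \<longleftrightarrow> (\<exists>A\<in>sets M. 0 < measure M A \<and> measure M A < 1)"
proof -
  have "{0, 1} \<subseteq> measure M ` sets M"
    by (metis empty_subsetI image_eqI insert_subset measure_empty prob_space
        sets.empty_sets sets.top)
  then have "nondegenerate M \<longleftrightarrow> (\<exists>A\<in>sets M. measure M A \<noteq> 0 \<and> measure M A \<noteq> 1)"
    unfolding nondegenerate_def by blast
  then show ?thesis
    by (metis less_irrefl measure_nonneg order_le_less prob_le_1)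
qed

text \<open>
  The inverse of a function \<open>w\<close> on \<open>I\<close>, as a function on \<open>w ` I\<close>, is \<open>inv_into I w\<close>.
  Only the values of \<open>h\<close> on \<open>space L \<times> space M\<close> matter below. For \<open>f\<close>, \<open>g\<close> continuous and
  injective on an interval \<open>I\<close> and \<open>L\<close>, \<open>M\<close> probability spaces, all integrands are bounded and
  measurable, and the inverses are applied only at points of \<open>f ` I\<close> and \<open>g ` I\<close>, respectively.
\<close>

definition switch_pair ::
  "real set \<Rightarrow> 'a measure \<Rightarrow> 'b measure \<Rightarrow> (real \<Rightarrow> real) \<Rightarrow> (real \<Rightarrow> real) \<Rightarrow> bool" where
  "switch_pair I L M f g \<longleftrightarrow>
     (\<forall>h \<in> borel_measurable (L \<Otimes>\<^sub>M M).
        (\<exists>K. compact K \<and> K \<subseteq> I \<and> h ` (space L \<times> space M) \<subseteq> K) \<longrightarrow>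
        inv_into I f (\<integral>x. f (inv_into I g (\<integral>y. g (h (x, y)) \<partial>M)) \<partial>L) =
        inv_into I g (\<integral>y. g (inv_into I f (\<integral>x. f (h (x, y)) \<partial>L)) \<partial>M))"

end

theory Submission
  imports Defs
begin

text \<open>
  If \<open>f = a g + b\<close>, the constants \<open>a\<close> and \<open>b\<close> pass through integrals, so \<open>f\<close> and \<open>g\<close> define
  the same mean value of a function, and both sides of the switch equation are the \<open>g\<close>-mean
  of \<open>h\<close> for the product measure, by Fubini's theorem (\<open>switch_pair_of_affine\<close>).

  For the converse, take sets \<open>A\<close> and \<open>B\<close> of probabilities \<open>p\<close> and \<open>q\<close> strictly between \<open>0\<close> and
  \<open>1\<close>, and functions \<open>h\<close> that are constant on the four rectangles that they determine. The
  switch equation then says that the two-point means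
  \<open>Mf s t = f\<^sup>-\<^sup>1 (p f(s) + (1 - p) f(t))\<close> and \<open>Mg s t = g\<^sup>-\<^sup>1 (q g(s) + (1 - q) g(t))\<close> commute
  (\<open>affine_of_switch_pair\<close>). In the coordinate \<open>u = g(x)\<close>, ranging over the interval \<open>J = g ` I\<close>, the
  mean \<open>Mg\<close> becomes the arithmetic one, and \<open>Mf\<close> becomes
  \<open>N(u, v) = \<phi>\<^sup>-\<^sup>1 (p \<phi>(u) + (1 - p) \<phi>(v))\<close> with \<open>\<phi> = f \<circ> g\<^sup>-\<^sup>1\<close>. Commutation says
  that \<open>N\<close> preserves combinations with weights \<open>q\<close> and \<open>1 - q\<close>, and it remains to show that
  \<open>\<phi>\<close> is affine (\<open>affine_of_bisymmetry\<close>).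

  An identity expressing a midpoint by nested combinations with one fixed weight turns the
  \<open>q\<close>-affinity of \<open>N\<close> into midpoint affinity (\<open>midpoint_affine_of_weighted_affine\<close>). The midpoint
  \<open>z\<close> of \<open>u\<close> and \<open>v\<close> is then the nested mean \<open>N(N(z, u), N(v, z))\<close>
  (\<open>midpoint_of_midpoint_affine_mean\<close>), and applying \<open>\<phi>\<close> yields
  \<open>\<phi>(z) = p (p \<phi>(z) + (1 - p) \<phi>(u)) + (1 - p) (p \<phi>(v) + (1 - p) \<phi>(z))\<close>, that is,
  \<open>\<phi>(z) = (\<phi>(u) + \<phi>(v)) / 2\<close>. A continuous midpoint-affine function is affine.
\<close>

section \<open>From midpoint affinity to affinity\<close>

text \<open>
  With \<open>r = 1 - p\<close> and \<open>z\<close> the midpoint of \<open>x\<close> and \<open>y\<close>,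
  \<open>z = p (p z + r x) + r (p y + r z)\<close>, because \<open>p\<^sup>2 + r\<^sup>2 + 2 p r = 1\<close>; this identity goes back to
  Daroczy and Pales. Applying \<open>F\<close> to it leaves an equation between \<open>F z\<close>, \<open>F x\<close> and \<open>F y\<close>
  that can be solved for \<open>F z\<close>.
\<close>

lemma midpoint_affine_of_weighted_affine:
  fixes F :: "'a::real_vector \<Rightarrow> real"
  assumes C: "convex C" and p: "0 < p" "p < 1"
    and F: "\<And>x y. x \<in> C \<Longrightarrow> y \<in> C \<Longrightarrow> F (p *\<^sub>R x + (1 - p) *\<^sub>R y) = p * F x + (1 - p) * F y"
    and xy: "x \<in> C" "y \<in> C"
  shows "F (midpoint x y) = (F x + F y) / 2"
proof -
  define z where "z = midpoint x y"
  define P where "P = p *\<^sub>R z + (1 - p) *\<^sub>R x"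
  define Q where "Q = p *\<^sub>R y + (1 - p) *\<^sub>R z"
  have zC: "z \<in> C"
    using convexD[OF C xy, of "1/2" "1/2"] by (simp add: z_def midpoint_def scaleR_add_right)
  have PC: "P \<in> C" and QC: "Q \<in> C"
    unfolding P_def Q_def using zC xy p by (auto intro!: convexD[OF C])
  have xy2: "x + y = 2 *\<^sub>R z"
    by (simp add: z_def midpoint_def)
  have "p *\<^sub>R (p *\<^sub>R z + r *\<^sub>R x) + r *\<^sub>R (p *\<^sub>R y + r *\<^sub>R z)
      = (p * p + r * r) *\<^sub>R z + (p * r) *\<^sub>R (x + y)" for r
    by (simp add: algebra_simps)
  then have "p *\<^sub>R P + (1 - p) *\<^sub>R Q
      = (p * p + (1 - p) * (1 - p)) *\<^sub>R z + (p * (1 - p)) *\<^sub>R (x + y)"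
    unfolding P_def Q_def .
  also have "\<dots> = (p * p + (1 - p) * (1 - p) + p * (1 - p) * 2) *\<^sub>R z"
    unfolding xy2 by (simp only: scaleR_scaleR scaleR_left_distrib)
  also have "p * p + (1 - p) * (1 - p) + p * (1 - p) * 2 = 1"
    by (simp add: algebra_simps)
  finally have "F z = p * F P + (1 - p) * F Q"
    using F[OF PC QC] by simp
  then have "p * (1 - p) * (2 * F z) = p * (1 - p) * (F x + F y)"
    unfolding P_def Q_def F[OF zC xy(1)] F[OF xy(2) zC] by (simp add: algebra_simps)
  then show ?thesis
    using p by (simp add: z_def)
qed

text \<open>
  Every point of the interval is the midpoint of a zero of \<open>G\<close>, namely the nearer end of the interval, and
  another point of the interval. Hence each value of \<open>G\<close> is half of another one, which is
  impossible for a nonzero value of maximal modulus.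
\<close>

lemma midpoint_affine_eq_zero:
  fixes G :: "real \<Rightarrow> real"
  assumes cont: "continuous_on {0..1} G"
    and mid: "\<And>s t. s \<in> {0..1} \<Longrightarrow> t \<in> {0..1} \<Longrightarrow> G (midpoint s t) = (G s + G t) / 2"
    and ends: "G 0 = 0" "G 1 = 0" and t: "t \<in> {0..1}"
  shows "G t = 0"
proof -
  have "continuous_on {0..1} (\<lambda>t. \<bar>G t\<bar>)"
    by (intro continuous_intros cont)
  then obtain m where m: "m \<in> {0..1}" and max: "\<And>t. t \<in> {0..1} \<Longrightarrow> \<bar>G t\<bar> \<le> \<bar>G m\<bar>"
    using continuous_attains_sup[of "{0..1::real}" "\<lambda>t. \<bar>G t\<bar>"] by auto
  have "\<bar>G m\<bar> \<le> \<bar>G m\<bar> / 2"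
  proof (cases "m \<le> 1/2")
    case True
    then have "G m = G (2 * m) / 2"
      using mid[of 0 "2 * m"] m ends by (simp add: midpoint_def)
    moreover have "\<bar>G (2 * m)\<bar> \<le> \<bar>G m\<bar>"
      using max[of "2 * m"] True m by simp
    ultimately show ?thesis by linarith
  next
    case False
    then have "G m = G (2 * m - 1) / 2"
      using mid[of 1 "2 * m - 1"] m ends by (simp add: midpoint_def)
    moreover have "\<bar>G (2 * m - 1)\<bar> \<le> \<bar>G m\<bar>"
      using max[of "2 * m - 1"] False m by simp
    ultimately show ?thesis by linarith
  qed
  then show ?thesis
    using max[OF t] by simp
qed

text \<open>
  The difference of \<open>\<phi>\<close> and its chord is midpoint affine and vanishes at both ends.
\<close>

lemma affine_on_segment_of_midpoint_affine:
  fixes \<phi> :: "real \<Rightarrow> real"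
  assumes cont: "continuous_on (closed_segment u v) \<phi>"
    and mid: "\<And>x y. x \<in> closed_segment u v \<Longrightarrow> y \<in> closed_segment u v
                \<Longrightarrow> \<phi> (midpoint x y) = (\<phi> x + \<phi> y) / 2"
    and t: "t \<in> {0..1}"
  shows "\<phi> ((1 - t) * u + t * v) = (1 - t) * \<phi> u + t * \<phi> v"
proof -
  define l where "l t = (1 - t) * u + t * v" for t :: real
  define G where "G t = \<phi> (l t) - ((1 - t) * \<phi> u + t * \<phi> v)" for t
  have seg: "l s \<in> closed_segment u v" if "s \<in> {0..1}" for s
    using that by (auto simp: l_def closed_segment_def)
  have "continuous_on {0..1} l"
    unfolding l_def by (intro continuous_intros)
  then have "continuous_on {0..1} (\<lambda>t. \<phi> (l t))"
    by (rule continuous_on_compose2[OF cont]) (use seg in auto)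
  then have "continuous_on {0..1} G"
    unfolding G_def by (intro continuous_intros)
  moreover have "G (midpoint r s) = (G r + G s) / 2" if rs: "r \<in> {0..1}" "s \<in> {0..1}" for r s
  proof -
    have "l (midpoint r s) = midpoint (l r) (l s)"
      by (simp add: l_def midpoint_def field_simps)
    then have "\<phi> (l (midpoint r s)) = (\<phi> (l r) + \<phi> (l s)) / 2"
      using mid[OF seg[OF rs(1)] seg[OF rs(2)]] by simp
    then show ?thesis
      unfolding G_def by (simp add: midpoint_def) (simp add: field_simps)
  qed
  moreover have "G 0 = 0" "G 1 = 0"
    by (simp_all add: G_def l_def)
  ultimately have "G t = 0"
    using t by (rule midpoint_affine_eq_zero)
  then show ?thesis
    by (simp add: G_def l_def)
qed

lemma affine_of_affine_on_segments:
  fixes \<phi> :: "real \<Rightarrow> real"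
  assumes seg: "\<And>u v t. u \<in> J \<Longrightarrow> v \<in> J \<Longrightarrow> t \<in> {0..1}
                  \<Longrightarrow> \<phi> ((1 - t) * u + t * v) = (1 - t) * \<phi> u + t * \<phi> v"
    and inj: "inj_on \<phi> J"
  shows "\<exists>a b. a \<noteq> 0 \<and> (\<forall>u\<in>J. \<phi> u = a * u + b)"
proof (cases "\<exists>u0\<in>J. \<exists>v0\<in>J. u0 < v0")
  case False
  show ?thesis
  proof (cases "J = {}")
    case False
    then obtain u0 where "u0 \<in> J" by blast
    then have "\<forall>u\<in>J. u = u0"
      using \<open>\<not> (\<exists>u0\<in>J. \<exists>v0\<in>J. u0 < v0)\<close> by (meson linorder_less_linear)
    then show ?thesis
      by (intro exI[of _ 1] exI[of _ "\<phi> u0 - u0"]) auto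
  qed (auto intro: exI[of _ 1])
next
  case True
  then obtain u0 v0 where uv: "u0 \<in> J" "v0 \<in> J" "u0 < v0" by blast
  \<comment> \<open>Collinearity of three points of the graph in a form that is symmetric up to relabelling, so
    that it serves whichever of \<open>w\<close>, \<open>u0\<close>, \<open>v0\<close> lies in the middle.\<close>
  have three: "(z - x) * \<phi> y = (z - y) * \<phi> x + (y - x) * \<phi> z"
    if "x \<in> J" "z \<in> J" "x \<le> y" "y \<le> z" for x y z
  proof (cases "x = z")
    case False
    define t where "t = (y - x) / (z - x)"
    have t: "t * (z - x) = y - x" "t \<in> {0..1}"
      using that False by (auto simp: t_def)
    have y: "y = (1 - t) * x + t * z"
      using t(1) by (simp add: algebra_simps)
    have "\<phi> y = (1 - t) * \<phi> x + t * \<phi> z"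
      using seg[OF that(1,2) t(2)] unfolding y[symmetric] .
    then have "(z - x) * \<phi> y = (z - x) * ((1 - t) * \<phi> x + t * \<phi> z)"
      by (rule arg_cong)
    also have "\<dots> = ((z - x) - t * (z - x)) * \<phi> x + (t * (z - x)) * \<phi> z"
      by (simp add: algebra_simps)
    finally show ?thesis
      unfolding t(1) by simp
  qed (use that in auto)
  define a where "a = (\<phi> v0 - \<phi> u0) / (v0 - u0)"
  have "\<phi> v0 \<noteq> \<phi> u0"
    using inj uv by (auto dest: inj_onD)
  then have "a \<noteq> 0"
    using uv by (simp add: a_def)
  moreover have "\<phi> w = a * w + (\<phi> u0 - a * u0)" if "w \<in> J" for w
  proof -
    have "(v0 - u0) * \<phi> w = (v0 - w) * \<phi> u0 + (w - u0) * \<phi> v0"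
    proof -
      consider "w \<le> u0" | "u0 \<le> w" "w \<le> v0" | "v0 \<le> w" by linarith
      then show ?thesis
      proof cases
        case 1
        show ?thesis using three[of w v0 u0] 1 uv that by (simp add: algebra_simps)
      next
        case 2
        show ?thesis using three[of u0 v0 w] 2 uv that by (simp add: algebra_simps)
      next
        case 3
        show ?thesis using three[of u0 w v0] 3 uv that by (simp add: algebra_simps)
      qed
    qed
    then have "(v0 - u0) * \<phi> w = (v0 - u0) * \<phi> u0 + (\<phi> v0 - \<phi> u0) * (w - u0)"
      by (simp add: algebra_simps)
    also have "\<phi> v0 - \<phi> u0 = (v0 - u0) * a"
      using uv by (simp add: a_def)
    also have "(v0 - u0) * \<phi> u0 + (v0 - u0) * a * (w - u0) = (v0 - u0) * (a * w + (\<phi> u0 - a * u0))"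
      by (simp add: algebra_simps)
    finally show ?thesis
      using uv by simp
  qed
  ultimately show ?thesis
    by blast
qed

section \<open>Bisymmetry of two quasi-arithmetic means\<close>

text \<open>
  This plays the same role as the identity behind \<open>midpoint_affine_of_weighted_affine\<close>, for the mean
  \<open>N\<close> instead of a weighted sum. With \<open>z\<close> the midpoint and \<open>w = N(v, u)\<close>, midpoint affinity and the
  diagonal values give \<open>N(z, u) = (u + w) / 2\<close> and \<open>N(v, z) = (v + w) / 2\<close>. This pair is the midpoint
  of \<open>(u, v)\<close> and \<open>(w, w)\<close>, so its mean is \<open>(N(u, v) + w) / 2\<close>, which is \<open>z\<close> since \<open>(z, z)\<close> is the
  midpoint of \<open>(u, v)\<close> and \<open>(v, u)\<close>.
\<close>

lemma midpoint_of_midpoint_affine_mean: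
  fixes N :: "real \<times> real \<Rightarrow> real"
  assumes mid: "\<And>x y. x \<in> J \<times> J \<Longrightarrow> y \<in> J \<times> J \<Longrightarrow> N (midpoint x y) = (N x + N y) / 2"
    and N: "\<And>x. x \<in> J \<times> J \<Longrightarrow> N x \<in> J" and diag: "\<And>u. u \<in> J \<Longrightarrow> N (u, u) = u"
    and J: "convex J" and uv: "u \<in> J" "v \<in> J"
  shows "N (N (midpoint u v, u), N (v, midpoint u v)) = midpoint u v"
proof -
  define z where "z = midpoint u v"
  have z: "z \<in> J" "z = (u + v) / 2"
    using convexD[OF J uv, of "1/2" "1/2"] by (simp_all add: z_def midpoint_def add_divide_distrib)
  define w where "w = N (v, u)"
  have w: "w \<in> J"
    using N uv by (simp add: w_def)
  have pair: "midpoint (s, t) (s', t') = ((s + s') / 2, (t + t') / 2)" for s t s' t' :: real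
    by (simp add: midpoint_def)
  have 1: "N (z, u) = (u + w) / 2"
    using mid[of "(u, u)" "(v, u)"] uv by (simp add: pair diag w_def z)
  have 2: "N (v, z) = (v + w) / 2"
    using mid[of "(v, u)" "(v, v)"] uv by (simp add: pair diag w_def z add.commute)
  have 3: "N (u, v) + w = 2 * z"
    using mid[of "(u, v)" "(v, u)"] uv diag[OF z(1)] by (simp add: pair w_def z(2) add.commute)
  have "N (N (z, u), N (v, z)) = (N (u, v) + N (w, w)) / 2"
    using mid[of "(u, v)" "(w, w)"] uv w by (simp add: 1 2 pair)
  then show ?thesis
    using 3 by (simp add: diag[OF w] flip: z_def)
qed

lemma inv_into_image_mixture:
  fixes f :: "real \<Rightarrow> real"
  assumes "convex (f ` I)" "s \<in> I" "t \<in> I" "0 < p" "p < 1"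
  shows "inv_into I f (p * f s + (1 - p) * f t) \<in> I"
    and "f (inv_into I f (p * f s + (1 - p) * f t)) = p * f s + (1 - p) * f t"
proof -
  have "p * f s + (1 - p) * f t \<in> f ` I"
    using convexD[OF assms(1), of "f s" "f t" p "1 - p"] assms by auto
  then show "inv_into I f (p * f s + (1 - p) * f t) \<in> I"
    and "f (inv_into I f (p * f s + (1 - p) * f t)) = p * f s + (1 - p) * f t"
    by (rule inv_into_into, rule f_inv_into_f)
qed

lemma convex_continuous_image:
  fixes f :: "real \<Rightarrow> real"
  assumes "is_interval I" "continuous_on I f"
  shows "convex (f ` I)"
  using connected_continuous_image[OF assms(2)] assms(1)
  by (simp add: is_interval_connected_1 flip: is_interval_convex_1)

text \<open>
  The coordinate \<open>u = g(x)\<close> on \<open>J = g ` I\<close> turns \<open>Mg\<close> into a weighted arithmetic mean, so that \<open>sym\<close>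
  becomes \<open>q\<close>-affinity of the transported mean \<open>N\<close> on the convex set \<open>J \<times> J\<close>.
\<close>

lemma affine_of_bisymmetry:
  fixes f g :: "real \<Rightarrow> real"
  assumes I: "is_interval I"
    and f: "continuous_on I f" "inj_on f I" and g: "continuous_on I g" "inj_on g I"
    and p: "0 < p" "p < 1" and q: "0 < q" "q < 1"
    and Mf: "\<And>s t. Mf s t = inv_into I f (p * f s + (1 - p) * f t)"
    and Mg: "\<And>s t. Mg s t = inv_into I g (q * g s + (1 - q) * g t)"
    and sym: "\<And>a b c d. a \<in> I \<Longrightarrow> b \<in> I \<Longrightarrow> c \<in> I \<Longrightarrow> d \<in> I
                \<Longrightarrow> Mf (Mg a b) (Mg c d) = Mg (Mf a c) (Mf b d)"
  shows "\<exists>a b. a \<noteq> 0 \<and> (\<forall>x\<in>I. f x = a * g x + b)"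
proof -
  define J where "J = g ` I"
  define k where "k = inv_into I g"
  define \<phi> where "\<phi> u = f (k u)" for u
  define N where "N = (\<lambda>(u, v). g (Mf (k u) (k v)))"
  have J: "convex J" and fI: "convex (f ` I)"
    unfolding J_def using convex_continuous_image I f g by auto
  have k: "k u \<in> I" "g (k u) = u" if "u \<in> J" for u
    using that by (auto simp: k_def J_def inv_into_into f_inv_into_f)
  have kg: "k (g x) = x" if "x \<in> I" for x
    using that g by (simp add: k_def)
  have MfI: "Mf s t \<in> I" and fMf: "f (Mf s t) = p * f s + (1 - p) * f t"
    if "s \<in> I" "t \<in> I" for s t
    unfolding Mf using inv_into_image_mixture[OF fI that p] by auto
  have gMg: "g (Mg s t) = q * g s + (1 - q) * g t" if "s \<in> I" "t \<in> I" for s t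
    unfolding Mg using inv_into_image_mixture[OF _ that q] J by (auto simp: J_def)
  have NJ: "N x \<in> J" if "x \<in> J \<times> J" for x
    using that k MfI by (auto simp: N_def J_def)
  have diag: "N (u, u) = u" if "u \<in> J" for u
  proof -
    have "Mf (k u) (k u) = inv_into I f (f (k u))"
      unfolding Mf by (simp add: algebra_simps)
    then show ?thesis
      using k[OF that] f by (simp add: N_def)
  qed
  have \<phi>N: "\<phi> (N (u, v)) = p * \<phi> u + (1 - p) * \<phi> v" if "u \<in> J" "v \<in> J" for u v
    using that k MfI fMf by (simp add: \<phi>_def N_def kg)
  have "N (q *\<^sub>R x + (1 - q) *\<^sub>R y) = q * N x + (1 - q) * N y"
    if xy: "x \<in> J \<times> J" "y \<in> J \<times> J" for x y
  proof -
    obtain u v u' v' where x: "x = (u, v)" and y: "y = (u', v')"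
      by (metis surj_pair)
    have uv: "u \<in> J" "v \<in> J" "u' \<in> J" "v' \<in> J"
      using xy by (auto simp: x y)
    have kM: "k (q * s + (1 - q) * t) = Mg (k s) (k t)" if "s \<in> J" "t \<in> J" for s t
      using k that by (simp add: Mg k_def)
    have "N (q *\<^sub>R x + (1 - q) *\<^sub>R y) = g (Mf (Mg (k u) (k u')) (Mg (k v) (k v')))"
      by (simp add: x y N_def kM uv)
    also have "\<dots> = g (Mg (Mf (k u) (k v)) (Mf (k u') (k v')))"
      by (simp add: sym k uv)
    also have "\<dots> = q * N x + (1 - q) * N y"
      by (simp add: gMg MfI k uv N_def x y)
    finally show ?thesis .
  qed
  then have Nmid: "N (midpoint x y) = (N x + N y) / 2" if "x \<in> J \<times> J" "y \<in> J \<times> J" for x y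
    using midpoint_affine_of_weighted_affine[OF convex_Times[OF J J] q] that by blast
  have \<phi>mid: "\<phi> (midpoint u v) = (\<phi> u + \<phi> v) / 2" if uv: "u \<in> J" "v \<in> J" for u v
  proof -
    define z where "z = midpoint u v"
    have z: "z \<in> J"
      using convexD[OF J uv, of "1/2" "1/2"] by (simp add: z_def midpoint_def add_divide_distrib)
    have "N (N (z, u), N (v, z)) = z"
      unfolding z_def by (rule midpoint_of_midpoint_affine_mean[OF Nmid NJ diag J uv])
    then have "\<phi> z = p * (p * \<phi> z + (1 - p) * \<phi> u) + (1 - p) * (p * \<phi> v + (1 - p) * \<phi> z)"
      using \<phi>N[of "N (z, u)" "N (v, z)"] NJ uv z by (simp add: \<phi>N)
    then have "p * (1 - p) * (2 * \<phi> z) = p * (1 - p) * (\<phi> u + \<phi> v)"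
      by (simp add: algebra_simps)
    then show ?thesis
      using p by (simp add: z_def)
  qed
  have "\<phi> ((1 - t) * u + t * v) = (1 - t) * \<phi> u + t * \<phi> v"
    if uv: "u \<in> J" "v \<in> J" and t: "t \<in> {0..1}" for u v t
  proof (rule affine_on_segment_of_midpoint_affine[OF _ _ t])
    \<comment> \<open>Only on a compact set is the inverse \<open>k\<close> of \<open>g\<close> immediately continuous; the image of \<open>S\<close>
      covers the segment from \<open>u\<close> to \<open>v\<close> because it is connected.\<close>
    define S where "S = closed_segment (k u) (k v)"
    have SI: "S \<subseteq> I"
      unfolding S_def using I k uv by (simp add: closed_segment_subset is_interval_convex_1)
    have gS: "continuous_on S g"
      using g(1) SI by (rule continuous_on_subset)
    have "is_interval S"
      by (simp add: S_def is_interval_convex_1)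
    then have "convex (g ` S)"
      using gS by (rule convex_continuous_image)
    moreover have "u \<in> g ` S" "v \<in> g ` S"
      using k uv by (force simp: S_def)+
    ultimately have seg: "closed_segment u v \<subseteq> g ` S"
      by (simp add: closed_segment_subset)
    have "continuous_on (g ` S) k"
      using gS SI kg by (intro continuous_on_inv) (auto simp: S_def)
    then have "continuous_on (g ` S) \<phi>"
      unfolding \<phi>_def
      by (rule continuous_on_compose2[OF f(1)]) (use SI kg in auto)
    then show "continuous_on (closed_segment u v) \<phi>"
      using seg continuous_on_subset by blast
    have "closed_segment u v \<subseteq> J"
      using J uv by (simp add: closed_segment_subset)
    then show "\<phi> (midpoint x y) = (\<phi> x + \<phi> y) / 2"
      if "x \<in> closed_segment u v" "y \<in> closed_segment u v" for x y
      using \<phi>mid that by blast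
  qed
  moreover have "inj_on \<phi> J"
    unfolding \<phi>_def by (intro inj_onI) (metis f(2) inj_onD k)
  ultimately obtain a b where "a \<noteq> 0" "\<forall>u\<in>J. \<phi> u = a * u + b"
    using affine_of_affine_on_segments by blast
  then show ?thesis
    by (intro exI[of _ a] exI[of _ b]) (auto simp: J_def \<phi>_def kg)
qed

section \<open>From switches to bisymmetry\<close>

lemma (in prob_space) integral_two_valued:
  fixes c d :: real
  assumes "A \<in> sets M"
  shows "(\<integral>x. (if x \<in> A then c else d) \<partial>M) = prob A * c + (1 - prob A) * d"
proof -
  have "integrable M (indicat_real A)"
    by (rule integrable_const_bound[of _ 1]) (use assms in \<open>auto simp: indicator_def\<close>)
  have "(\<integral>x. (if x \<in> A then c else d) \<partial>M) = (\<integral>x. d + indicator A x * (c - d) \<partial>M)"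
    by (intro Bochner_Integration.integral_cong) auto
  also have "\<dots> = d + prob A * (c - d)"
    using assms \<open>integrable M (indicat_real A)\<close>
    by (subst Bochner_Integration.integral_add) (auto simp: prob_space)
  finally show ?thesis
    by (simp add: algebra_simps)
qed

text \<open>
  Functions \<open>h\<close> that are constant on the four rectangles given by one set in each factor suffice.
\<close>

lemma affine_of_switch_pair:
  fixes f g :: "real \<Rightarrow> real" and L :: "'a measure" and M :: "'b measure"
  assumes I: "is_interval I"
    and f: "continuous_on I f" "inj_on f I" and g: "continuous_on I g" "inj_on g I"
    and L: "prob_space L" "nondegenerate L" and M: "prob_space M" "nondegenerate M"
    and switch: "switch_pair I L M f g"
  shows "\<exists>a b. a \<noteq> 0 \<and> (\<forall>x\<in>I. f x = a * g x + b)"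
proof -
  interpret L: prob_space L by fact
  interpret M: prob_space M by fact
  obtain A where A: "A \<in> sets L" "0 < measure L A" "measure L A < 1"
    using L by (auto simp: L.nondegenerate_iff)
  obtain B where B: "B \<in> sets M" "0 < measure M B" "measure M B < 1"
    using M by (auto simp: M.nondegenerate_iff)
  define Mf where "Mf s t = inv_into I f (measure L A * f s + (1 - measure L A) * f t)" for s t
  define Mg where "Mg s t = inv_into I g (measure M B * g s + (1 - measure M B) * g t)" for s t
  have "Mf (Mg a b) (Mg c d) = Mg (Mf a c) (Mf b d)"
    if abcd: "a \<in> I" "b \<in> I" "c \<in> I" "d \<in> I" for a b c d
  proof -
    define h where
      "h = (\<lambda>(x, y). if x \<in> A then (if y \<in> B then a else b) else (if y \<in> B then c else d))"
    have [measurable]: "A \<in> sets L" "B \<in> sets M"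
      using A B by auto
    have "h \<in> borel_measurable (L \<Otimes>\<^sub>M M)"
      unfolding h_def by measurable
    moreover have "compact {a, b, c, d}" "{a, b, c, d} \<subseteq> I"
      "h ` (space L \<times> space M) \<subseteq> {a, b, c, d}"
      using abcd by (auto simp: h_def)
    ultimately have "inv_into I f (\<integral>x. f (inv_into I g (\<integral>y. g (h (x, y)) \<partial>M)) \<partial>L) =
        inv_into I g (\<integral>y. g (inv_into I f (\<integral>x. f (h (x, y)) \<partial>L)) \<partial>M)"
      using switch unfolding switch_pair_def by blast
    moreover have "inv_into I g (\<integral>y. g (h (x, y)) \<partial>M) = (if x \<in> A then Mg a b else Mg c d)" for x
      by (simp add: h_def Mg_def if_distrib[of g] M.integral_two_valued[OF B(1)])
    moreover have "inv_into I f (\<integral>x. f (h (x, y)) \<partial>L) = (if y \<in> B then Mf a c else Mf b d)" for y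
      by (simp add: h_def Mf_def if_distrib[of f] L.integral_two_valued[OF A(1)])
    ultimately show ?thesis
      by (simp add: if_distrib[of f] if_distrib[of g] M.integral_two_valued[OF B(1)]
          L.integral_two_valued[OF A(1)] flip: Mf_def Mg_def)
  qed
  then show ?thesis
    by (intro affine_of_bisymmetry[OF I f g A(2,3) B(2,3) Mf_def Mg_def])
qed

section \<open>From affine dependence to switches\<close>

lemma measurable_continuous_on_compact_comp:
  fixes h :: "'c \<Rightarrow> real" and g :: "real \<Rightarrow> real"
  assumes h: "h \<in> borel_measurable N" and K: "compact K" "h ` space N \<subseteq> K"
    and g: "continuous_on K g"
  shows "(\<lambda>x. g (h x)) \<in> borel_measurable N"
proof -
  have "h \<in> measurable N (restrict_space borel K)"
    using h K by (auto simp: measurable_restrict_space2_iff)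
  then show ?thesis
    using borel_measurable_continuous_on_restrict[OF g] by (rule measurable_compose)
qed

lemma (in prob_space) integral_mem_Icc:
  fixes G :: "'a \<Rightarrow> real"
  assumes G: "G \<in> borel_measurable M" and bounds: "\<And>x. x \<in> space M \<Longrightarrow> G x \<in> {m..m'}"
  shows "integrable M G" and "(\<integral>x. G x \<partial>M) \<in> {m..m'}"
proof -
  show int: "integrable M G"
    by (rule integrable_const_bound[of _ "max \<bar>m\<bar> \<bar>m'\<bar>", OF AE_I2 G]) (use bounds in force)
  show "(\<integral>x. G x \<partial>M) \<in> {m..m'}"
    using integral_ge_const[OF int AE_I2] integral_le_const[OF int AE_I2] bounds by auto
qed

text \<open>
  Both sides equal \<open>g\<^sup>-\<^sup>1\<close> of the iterated integral of \<open>H = g \<circ> h\<close>. All inner integrals stay in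
  the range \<open>[g s, g s']\<close> of \<open>g\<close> on \<open>K\<close>, which is a part of the interval \<open>g ` I\<close>, so the inverses
  cancel where they should.
\<close>

lemma switch_pair_of_affine:
  fixes f g :: "real \<Rightarrow> real" and L :: "'a measure" and M :: "'b measure"
  assumes I: "is_interval I"
    and f: "inj_on f I" and g: "continuous_on I g" "inj_on g I"
    and L: "prob_space L" and M: "prob_space M"
    and fg: "\<And>x. x \<in> I \<Longrightarrow> f x = a * g x + b"
  shows "switch_pair I L M f g"
  unfolding switch_pair_def
proof (intro ballI impI)
  interpret L: prob_space L by fact
  interpret M: prob_space M by fact
  interpret LM: pair_prob_space L M ..
  fix h :: "'a \<times> 'b \<Rightarrow> real"
  assume h: "h \<in> borel_measurable (L \<Otimes>\<^sub>M M)"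
    and "\<exists>K. compact K \<and> K \<subseteq> I \<and> h ` (space L \<times> space M) \<subseteq> K"
  then obtain K where K: "compact K" "K \<subseteq> I" "h ` (space L \<times> space M) \<subseteq> K" by blast
  have gK: "continuous_on K g"
    using g K continuous_on_subset by blast
  have "K \<noteq> {}"
    using K L.not_empty M.not_empty by blast
  obtain s where s: "s \<in> K" "\<forall>x\<in>K. g s \<le> g x"
    using continuous_attains_inf[OF K(1) \<open>K \<noteq> {}\<close> gK] by blast
  obtain s' where s': "s' \<in> K" "\<forall>x\<in>K. g x \<le> g s'"
    using continuous_attains_sup[OF K(1) \<open>K \<noteq> {}\<close> gK] by blast
  from s s' have gs: "g x \<in> {g s..g s'}" if "x \<in> K" for x
    using that by simp
  have "is_interval (g ` I)"
    using convex_continuous_image[OF I g(1)] by (simp add: is_interval_convex_1)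
  then have gI: "w \<in> g ` I" if "w \<in> {g s..g s'}" for w
    by (rule mem_is_interval_1_I[of _ "g s" "g s'"]) (use s s' K that in auto)
  define H where "H = (\<lambda>(x, y). g (h (x, y)))"
  have Hm: "H \<in> borel_measurable (L \<Otimes>\<^sub>M M)"
    using measurable_continuous_on_compact_comp[OF h K(1) _ gK] K(3)
    by (simp add: H_def space_pair_measure)
  have H: "H (x, y) \<in> {g s..g s'}" if "x \<in> space L" "y \<in> space M" for x y
  proof -
    have "h (x, y) \<in> K"
      using K(3) that by blast
    then show ?thesis
      using gs by (simp add: H_def)
  qed
  have intM: "(\<integral>y. H (x, y) \<partial>M) \<in> {g s..g s'}" if x: "x \<in> space L" for x
  proof (rule M.integral_mem_Icc(2))
    show "(\<lambda>y. H (x, y)) \<in> borel_measurable M"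
      using measurable_Pair2[OF Hm x] .
  qed (rule H[OF x])
  have intL: "integrable L (\<lambda>x. H (x, y))" "(\<integral>x. H (x, y) \<partial>L) \<in> {g s..g s'}"
    if y: "y \<in> space M" for y
    using L.integral_mem_Icc[OF measurable_Pair1[OF Hm y] H[OF _ y]] by simp_all
  have outer: "(\<lambda>x. \<integral>y. H (x, y) \<partial>M) \<in> borel_measurable L"
    using Hm by (intro M.borel_measurable_lebesgue_integral) (simp add: case_prod_eta)
  have intLM: "integrable L (\<lambda>x. \<integral>y. H (x, y) \<partial>M)"
    "(\<integral>x. (\<integral>y. H (x, y) \<partial>M) \<partial>L) \<in> {g s..g s'}"
    by (rule L.integral_mem_Icc[OF outer intM], assumption)+
  have "H z \<in> {g s..g s'}" if "z \<in> space (L \<Otimes>\<^sub>M M)" for z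
    using that H by (cases z) (simp add: space_pair_measure)
  then have "integrable (L \<Otimes>\<^sub>M M) H"
    by (rule LM.P.integral_mem_Icc(1)[OF Hm])
  then have fubini: "(\<integral>y. (\<integral>x. H (x, y) \<partial>L) \<partial>M) = (\<integral>x. (\<integral>y. H (x, y) \<partial>M) \<partial>L)"
    using LM.Fubini_integral[of "\<lambda>x y. H (x, y)"] by (simp add: case_prod_eta)
  have inv_f: "inv_into I f (a * w + b) = inv_into I g w" if "w \<in> {g s..g s'}" for w
  proof -
    have "w \<in> g ` I"
      using that by (rule gI)
    then obtain x where x: "x \<in> I" "w = g x" by blast
    then have "inv_into I f (f x) = inv_into I g (g x)"
      using f g by simp
    then show ?thesis
      using x fg by simp
  qed
  have f_inv: "f (inv_into I g w) = a * w + b" if "w \<in> {g s..g s'}" for w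
    using gI[OF that] fg by (simp add: inv_into_into f_inv_into_f)
  have "(\<integral>x. f (inv_into I g (\<integral>y. g (h (x, y)) \<partial>M)) \<partial>L) = (\<integral>x. a * (\<integral>y. H (x, y) \<partial>M) + b \<partial>L)"
    by (intro Bochner_Integration.integral_cong) (use f_inv intM in \<open>simp_all add: H_def\<close>)
  also have "\<dots> = a * (\<integral>x. (\<integral>y. H (x, y) \<partial>M) \<partial>L) + b"
    using intLM by (simp add: L.prob_space)
  finally have lhs: "inv_into I f (\<integral>x. f (inv_into I g (\<integral>y. g (h (x, y)) \<partial>M)) \<partial>L)
      = inv_into I g (\<integral>x. (\<integral>y. H (x, y) \<partial>M) \<partial>L)"
    using inv_f intLM by simp
  have "g (inv_into I f (\<integral>x. f (h (x, y)) \<partial>L)) = (\<integral>x. H (x, y) \<partial>L)" if y: "y \<in> space M" for y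
  proof -
    have "h (x, y) \<in> I" if "x \<in> space L" for x
      using K that y by blast
    then have "(\<integral>x. f (h (x, y)) \<partial>L) = (\<integral>x. a * H (x, y) + b \<partial>L)"
      by (intro Bochner_Integration.integral_cong) (simp_all add: H_def fg)
    also have "\<dots> = a * (\<integral>x. H (x, y) \<partial>L) + b"
      using intL[OF y] by (simp add: L.prob_space)
    finally show ?thesis
      using inv_f gI intL[OF y] by (simp add: f_inv_into_f)
  qed
  then have "(\<integral>y. g (inv_into I f (\<integral>x. f (h (x, y)) \<partial>L)) \<partial>M) = (\<integral>y. (\<integral>x. H (x, y) \<partial>L) \<partial>M)"
    by (intro Bochner_Integration.integral_cong) simp_all
  then show "inv_into I f (\<integral>x. f (inv_into I g (\<integral>y. g (h (x, y)) \<partial>M)) \<partial>L) =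
        inv_into I g (\<integral>y. g (inv_into I f (\<integral>x. f (h (x, y)) \<partial>L)) \<partial>M)"
    using lhs fubini by simp
qed

theorem mainTheorem1:
  fixes I :: "real set" and f g :: "real \<Rightarrow> real"
    and L :: "'a measure" and M :: "'b measure"
  assumes "is_interval I" and "I \<noteq> {}"
    and "continuous_on I f" and "inj_on f I"
    and "continuous_on I g" and "inj_on g I"
    and "prob_space L" and "prob_space M"
    and "nondegenerate L" and "nondegenerate M"
  shows "switch_pair I L M f g \<longleftrightarrow>
    (\<exists>a b. a \<noteq> 0 \<and> (\<forall>x\<in>I. f x = a * g x + b))"
  using affine_of_switch_pair[of I f g L M] switch_pair_of_affine[of I f g L M] assms by blast

end
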